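(* Let $A$ be a weakly amenable Banach algebra with property $\mathbb{B}$ and having a bounded approximate identity. Then $A$ is a zero Lie product determined Banach algebra.
   Context: Banach algebras are complex; $A^*$ is the dual space of $A$, which is a Banach $A$-bimodule via $(a\cdot f)(c)=f(ca)$, $(f\cdot a)(c)=f(ac)$ for $a,c\in A$, $f\in A^*$. A derivation $\delta\colon A\to A^*$ is a linear map with $\delta(ab)=\delta(a)\cdot b+a\cdot\delta(b)$ for all $a,b\in A$; it is inner if there is $\omega\in A^*$ with $\delta(a)=a\cdot\omega-\omega\cdot a$ for all $a\in A$. $A$ is weakly amenable if every continuous derivation from $A$ into $A^*$ is inner. $A$ has property $\mathbb{B}$ if every continuous bilinear functional $\varphi\colon A\times A\to\mathbb{C}$ such that $ab=0$ implies $\varphi(a,b)=0$ (for $a,b\in A$) satisfies $\varphi(ab,c)=\varphi(a,bc)$ for all $a,b,c\in A$. Approximate identities are two-sided. $A$ is a zero Lie product determined Banach algebra if for every continuous bilinear functional $\varphi\colon A\times A\to\mathbb{C}$ satisfying $\varphi(a,b)=0$ whenever $a,b\in A$ and $ab=ba$, there exists $\omega\in A^*$ such that $\varphi(a,b)=\omega(ab-ba)$ for all $a,b\in A$. *)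

theory Defs
  imports "HOL-Analysis.Analysis"
begin

section \<open>Complex Banach algebras\<close>

text \<open>
  The library only has real normed algebras. A complex Banach algebra, not assumed unital or
  commutative, is a real one with a compatible complex scalar multiplication.
\<close>

class complex_banach_algebra = real_normed_algebra + banach +
  fixes scaleC :: "complex \<Rightarrow> 'a \<Rightarrow> 'a"  (infixr \<open>*\<^sub>C\<close> 75)
  assumes scaleC_add_right: "c *\<^sub>C (x + y) = c *\<^sub>C x + c *\<^sub>C y"
    and scaleC_add_left: "(c + d) *\<^sub>C x = c *\<^sub>C x + d *\<^sub>C x"
    and scaleC_scaleC: "c *\<^sub>C (d *\<^sub>C x) = (c * d) *\<^sub>C x"
    and scaleC_of_real: "complex_of_real r *\<^sub>C x = r *\<^sub>R x"
    and mult_scaleC_left: "(c *\<^sub>C x) * y = c *\<^sub>C (x * y)"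
    and mult_scaleC_right: "x * (c *\<^sub>C y) = c *\<^sub>C (x * y)"
    and norm_scaleC: "norm (c *\<^sub>C x) = cmod c * norm x"

instantiation complex :: complex_banach_algebra
begin

definition scaleC_complex :: "complex \<Rightarrow> complex \<Rightarrow> complex"
  where "scaleC_complex c x = c * x"

instance
  by standard (simp_all add: scaleC_complex_def algebra_simps norm_mult scaleR_conv_of_real)

end

section \<open>The dual bimodule and derivations into it\<close>

text \<open>
  The type \<open>'a \<Rightarrow>\<^sub>L complex\<close> carries the operator norm, but its elements are only real-linear;
  the dual space consists of the complex-linear ones.
\<close>

definition dual_space :: "('a::complex_banach_algebra \<Rightarrow>\<^sub>L complex) set"
  where "dual_space = {f. \<forall>c x. blinfun_apply f (c *\<^sub>C x) = c * blinfun_apply f x}"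

definition dual_scale :: "complex \<Rightarrow> ('a::complex_banach_algebra \<Rightarrow>\<^sub>L complex) \<Rightarrow> ('a \<Rightarrow>\<^sub>L complex)"
  where "dual_scale c f = blinfun_mult_right c o\<^sub>L f"

definition dual_lact :: "'a::complex_banach_algebra \<Rightarrow> ('a \<Rightarrow>\<^sub>L complex) \<Rightarrow> ('a \<Rightarrow>\<^sub>L complex)"
  where "dual_lact a f = f o\<^sub>L blinfun_mult_left a"

definition dual_ract :: "('a::complex_banach_algebra \<Rightarrow>\<^sub>L complex) \<Rightarrow> 'a \<Rightarrow> ('a \<Rightarrow>\<^sub>L complex)"
  where "dual_ract f a = f o\<^sub>L blinfun_mult_right a"

lemma dual_action_apply:
  "blinfun_apply (dual_scale c f) x = c * blinfun_apply f x"
  "blinfun_apply (dual_lact a f) x = blinfun_apply f (x * a)"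
  "blinfun_apply (dual_ract f a) x = blinfun_apply f (a * x)"
  by (simp_all add: dual_scale_def dual_lact_def dual_ract_def
      blinfun_mult_left.rep_eq blinfun_mult_right.rep_eq)

lemma dual_space_closed:
  assumes "f \<in> dual_space"
  shows "dual_scale c f \<in> dual_space" "dual_lact a f \<in> dual_space" "dual_ract f a \<in> dual_space"
  using assms
  by (simp_all add: dual_space_def dual_action_apply mult_scaleC_left mult_scaleC_right)

definition dual_derivation :: "('a::complex_banach_algebra \<Rightarrow> ('a \<Rightarrow>\<^sub>L complex)) \<Rightarrow> bool"
  where "dual_derivation \<delta> \<longleftrightarrow>
    (\<forall>a. \<delta> a \<in> dual_space) \<and>
    (\<forall>a b. \<delta> (a + b) = \<delta> a + \<delta> b) \<and>
    (\<forall>c a. \<delta> (c *\<^sub>C a) = dual_scale c (\<delta> a)) \<and>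
    (\<forall>a b. \<delta> (a * b) = dual_ract (\<delta> a) b + dual_lact a (\<delta> b))"

definition inner_derivation :: "('a::complex_banach_algebra \<Rightarrow> ('a \<Rightarrow>\<^sub>L complex)) \<Rightarrow> bool"
  where "inner_derivation \<delta> \<longleftrightarrow>
    (\<exists>\<omega>\<in>dual_space. \<forall>a. \<delta> a = dual_lact a \<omega> - dual_ract \<omega> a)"

definition weakly_amenable :: "'a::complex_banach_algebra itself \<Rightarrow> bool"
  where "weakly_amenable T \<longleftrightarrow>
    (\<forall>\<delta> :: 'a \<Rightarrow> ('a \<Rightarrow>\<^sub>L complex).
      dual_derivation \<delta> \<and> continuous_on UNIV \<delta> \<longrightarrow> inner_derivation \<delta>)"

section \<open>Continuous bilinear functionals\<close>

text \<open>
  The library predicate \<open>bounded_bilinear\<close> gives joint continuity and real bilinearity.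
\<close>

definition continuous_bilinear_functional ::
    "('a::complex_banach_algebra \<Rightarrow> 'a \<Rightarrow> complex) \<Rightarrow> bool"
  where "continuous_bilinear_functional \<phi> \<longleftrightarrow>
    bounded_bilinear \<phi> \<and>
    (\<forall>c a b. \<phi> (c *\<^sub>C a) b = c * \<phi> a b) \<and>
    (\<forall>c a b. \<phi> a (c *\<^sub>C b) = c * \<phi> a b)"

definition property_B :: "'a::complex_banach_algebra itself \<Rightarrow> bool"
  where "property_B T \<longleftrightarrow>
    (\<forall>\<phi> :: 'a \<Rightarrow> 'a \<Rightarrow> complex.
      continuous_bilinear_functional \<phi> \<and> (\<forall>a b. a * b = 0 \<longrightarrow> \<phi> a b = 0) \<longrightarrow>
      (\<forall>a b c. \<phi> (a * b) c = \<phi> a (b * c)))"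

definition zero_Lie_product_determined :: "'a::complex_banach_algebra itself \<Rightarrow> bool"
  where "zero_Lie_product_determined T \<longleftrightarrow>
    (\<forall>\<phi> :: 'a \<Rightarrow> 'a \<Rightarrow> complex.
      continuous_bilinear_functional \<phi> \<and> (\<forall>a b. a * b = b * a \<longrightarrow> \<phi> a b = 0) \<longrightarrow>
      (\<exists>\<omega>\<in>dual_space. \<forall>a b. \<phi> a b = blinfun_apply \<omega> (a * b - b * a)))"

section \<open>Bounded approximate identities\<close>

text \<open>
  A net \<open>e\<close> over a directed index set is rendered by the library's filter limits: \<open>F\<close> is the
  (proper) filter of tails of the index set. The index type is left arbitrary.
\<close>

definition bounded_approximate_identity ::
    "'i filter \<Rightarrow> ('i \<Rightarrow> 'a::complex_banach_algebra) \<Rightarrow> bool"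
  where "bounded_approximate_identity F e \<longleftrightarrow>
    F \<noteq> bot \<and> bounded (range e) \<and>
    (\<forall>a. ((\<lambda>i. e i * a) \<longlongrightarrow> a) F) \<and>
    (\<forall>a. ((\<lambda>i. a * e i) \<longlongrightarrow> a) F)"

end

theory Submission
  imports Defs
begin

text \<open>
  Let \<open>\<phi>\<close> be a continuous bilinear functional that vanishes on commuting pairs. Weak amenability
  produces the representing functional as soon as \<open>a \<mapsto> \<phi>(a, \<cdot>)\<close> is a derivation into the dual. As
  \<open>\<phi>\<close> is alternating, that is the vanishing of the cyclic sum
  \<open>T(x, y, z) = \<phi>(x, yz) + \<phi>(y, zx) + \<phi>(z, xy)\<close>.

  If \<open>ab = 0\<close> and \<open>cd = 0\<close> then \<open>da\<close> and \<open>bc\<close> have zero product in both orders, so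
  \<open>\<phi>(da, bc) = 0\<close>. Applying property B in the pair \<open>(a, b)\<close> and then in the pair \<open>(c, d)\<close>, and
  removing superfluous factors with the approximate identity, gives a four-variable identity for
  \<open>\<phi>\<close> (\<open>four_factor_identity\<close>). It says exactly that \<open>T(ab, c, d) = T(a, bc, d)\<close>
  (\<open>cyclic_sum_shift\<close>): like a trace of a product, \<open>T\<close> is cyclic and sees only the product of its
  arguments.

  On the other hand \<open>x\<close> commutes with \<open>x\<^sup>2\<close>, and polarising \<open>\<phi>(x, x\<^sup>2) = 0\<close> shows that exchanging two
  arguments of \<open>T\<close> changes its sign (\<open>cyclic_sum_swap\<close>). The two properties clash on four
  factors \<open>a, b, c, d\<close>: moving \<open>d\<close> past \<open>bc\<close> is one exchange if \<open>bc\<close> is one argument, but two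
  exchanges if \<open>b\<close> and \<open>c\<close> are passed separately. So \<open>T(ab, c, d) = 0\<close>
  (\<open>cyclic_sum_product_eq_0\<close>), and letting \<open>b\<close> run through the approximate identity
  gives \<open>T = 0\<close>.
\<close>

section \<open>Constructing continuous bilinear functionals\<close>

lemma bounded_bilinear_diff:
  fixes f g :: "'a::real_normed_vector \<Rightarrow> 'b::real_normed_vector \<Rightarrow> 'c::real_normed_vector"
  assumes f: "bounded_bilinear f" and g: "bounded_bilinear g"
  shows "bounded_bilinear (\<lambda>x y. f x y - g x y)"
proof -
  interpret f: bounded_bilinear f by (rule f)
  interpret g: bounded_bilinear g by (rule g)
  obtain K where K: "norm (f x y) \<le> norm x * norm y * K" for x y
    using f.bounded by blast
  obtain L where L: "norm (g x y) \<le> norm x * norm y * L" for x y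
    using g.bounded by blast
  have "norm (f x y - g x y) \<le> norm x * norm y * (K + L)" for x y
    using norm_triangle_ineq4[of "f x y" "g x y"] K[of x y] L[of x y]
    by (simp add: distrib_left)
  then show ?thesis
    by unfold_locales
      (auto simp: f.add_left f.add_right g.add_left g.add_right
        f.scaleR_left f.scaleR_right g.scaleR_left g.scaleR_right scaleR_diff_right)
qed

lemma continuous_bilinear_functional_diff:
  assumes "continuous_bilinear_functional \<phi>" and "continuous_bilinear_functional \<psi>"
  shows "continuous_bilinear_functional (\<lambda>a b. \<phi> a b - \<psi> a b)"
  using assms
  by (simp add: continuous_bilinear_functional_def bounded_bilinear_diff right_diff_distrib)

lemma continuous_bilinear_functional_flip:
  assumes "continuous_bilinear_functional \<phi>"
  shows "continuous_bilinear_functional (\<lambda>a b. \<phi> b a)"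
  using assms by (simp add: continuous_bilinear_functional_def bounded_bilinear.flip)

lemma continuous_bilinear_functional_mult:
  assumes "continuous_bilinear_functional \<phi>"
  shows "continuous_bilinear_functional (\<lambda>a b. \<phi> (p * a) (b * q))"
    and "continuous_bilinear_functional (\<lambda>a b. \<phi> (a * p) (q * b))"
proof -
  have \<phi>: "bounded_bilinear \<phi>"
    using assms by (simp add: continuous_bilinear_functional_def)
  show "continuous_bilinear_functional (\<lambda>a b. \<phi> (p * a) (b * q))"
    using assms bounded_bilinear.comp[OF \<phi> bounded_linear_mult_right bounded_linear_mult_left]
    by (simp add: continuous_bilinear_functional_def mult_scaleC_left mult_scaleC_right)
  show "continuous_bilinear_functional (\<lambda>a b. \<phi> (a * p) (q * b))"
    using assms bounded_bilinear.comp[OF \<phi> bounded_linear_mult_left bounded_linear_mult_right]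
    by (simp add: continuous_bilinear_functional_def mult_scaleC_left mult_scaleC_right)
qed

section \<open>Two-sided zero products and property B\<close>

lemma property_B_D:
  fixes \<phi> :: "'a::complex_banach_algebra \<Rightarrow> 'a \<Rightarrow> complex"
  assumes "property_B TYPE('a)" "continuous_bilinear_functional \<phi>"
    and "\<And>a b. a * b = 0 \<Longrightarrow> \<phi> a b = 0"
  shows "\<phi> (a * b) c = \<phi> a (b * c)"
  using assms unfolding property_B_def by blast

text \<open>
  Property B starts from the single condition \<open>a * b = 0\<close>, whereas \<open>\<phi>\<close> is only known to vanish if
  the product is zero in both orders. The pair \<open>d * a\<close>, \<open>b * c\<close> satisfies both conditions once
  \<open>a * b = 0\<close> and \<open>c * d = 0\<close>. These concern disjoint sets of variables, so property B can be
  applied first in \<open>a, b\<close> and then in \<open>c, d\<close>.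
\<close>

lemma six_factor_identity:
  fixes \<phi> :: "'a::complex_banach_algebra \<Rightarrow> 'a \<Rightarrow> complex"
  assumes B: "property_B TYPE('a)" and \<phi>: "continuous_bilinear_functional \<phi>"
    and zero: "\<forall>a b. a * b = 0 \<and> b * a = 0 \<longrightarrow> \<phi> a b = 0"
  shows "\<phi> (d * a * b) (x * c * y) - \<phi> (d * a) (b * x * c * y)
       = \<phi> (y * d * a * b) (x * c) - \<phi> (y * d * a) (b * x * c)"
proof -
  have inner: "\<phi> (d * (a * b)) (x * c) = \<phi> (d * a) (b * x * c)" if cd: "c * d = 0" for c d
  proof (rule property_B_D[OF B continuous_bilinear_functional_mult(1)[OF \<phi>, of d c]])
    fix u v :: 'a
    assume uv: "u * v = 0"
    have "(d * u) * (v * c) = d * (u * v) * c" and "(v * c) * (d * u) = v * (c * d) * u"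
      by (simp_all only: mult.assoc)
    then show "\<phi> (d * u) (v * c) = 0"
      by (intro zero[rule_format]) (simp add: uv cd)
  qed
  let ?\<psi> = "\<lambda>c d. \<phi> (d * (a * b)) (x * c) - \<phi> (d * a) (b * x * c)"
  have "?\<psi> (c * y) d = ?\<psi> c (y * d)"
  proof (rule property_B_D[OF B, of ?\<psi>])
    show "continuous_bilinear_functional ?\<psi>"
      by (rule continuous_bilinear_functional_diff[OF
            continuous_bilinear_functional_flip[OF continuous_bilinear_functional_mult(2)[OF \<phi>, of "a * b" x]]
            continuous_bilinear_functional_flip[OF continuous_bilinear_functional_mult(2)[OF \<phi>, of a "b * x"]]])
  qed (simp add: inner)
  then show ?thesis
    by (simp add: mult.assoc)
qed

text \<open>
  In every term of the six-factor identity \<open>d\<close> stands next to \<open>a\<close>, and \<open>x\<close> stands next to \<open>c\<close>.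
  Hence the approximate identity can be substituted for \<open>d\<close> and then for \<open>c\<close>, and it is absorbed
  in the limit.
\<close>

lemma four_factor_identity:
  fixes \<phi> :: "'a::complex_banach_algebra \<Rightarrow> 'a \<Rightarrow> complex" and e :: "'i \<Rightarrow> 'a"
  assumes B: "property_B TYPE('a)" and \<phi>: "continuous_bilinear_functional \<phi>"
    and zero: "\<forall>a b. a * b = 0 \<and> b * a = 0 \<longrightarrow> \<phi> a b = 0"
    and e: "bounded_approximate_identity F e"
  shows "\<phi> (a * b) (c * d) - \<phi> a (b * c * d) = \<phi> (d * a * b) c - \<phi> (d * a) (b * c)"
proof -
  have F: "F \<noteq> bot"
    and el: "((\<lambda>i. e i * z) \<longlongrightarrow> z) F" and er: "((\<lambda>i. z * e i) \<longlongrightarrow> z) F" for z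
    using e by (auto simp: bounded_approximate_identity_def)
  interpret bounded_bilinear \<phi>
    using \<phi> by (simp add: continuous_bilinear_functional_def)
  have five: "\<phi> (a * b) (x * c * y) - \<phi> a (b * x * c * y)
      = \<phi> (y * a * b) (x * c) - \<phi> (y * a) (b * x * c)" for x c y
  proof (rule tendsto_unique[OF F])
    show "((\<lambda>i. \<phi> (e i * a * b) (x * c * y) - \<phi> (e i * a) (b * x * c * y)) \<longlongrightarrow>
        \<phi> (a * b) (x * c * y) - \<phi> a (b * x * c * y)) F"
      by (intro tendsto_diff tendsto tendsto_mult el tendsto_const)
    have "((\<lambda>i. \<phi> (y * (e i * a) * b) (x * c) - \<phi> (y * (e i * a)) (b * x * c)) \<longlongrightarrow>
        \<phi> (y * a * b) (x * c) - \<phi> (y * a) (b * x * c)) F"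
      by (intro tendsto_diff tendsto tendsto_mult el tendsto_const)
    then show "((\<lambda>i. \<phi> (e i * a * b) (x * c * y) - \<phi> (e i * a) (b * x * c * y)) \<longlongrightarrow>
        \<phi> (y * a * b) (x * c) - \<phi> (y * a) (b * x * c)) F"
      using six_factor_identity[OF B \<phi> zero, of "e _" a b x c y] by (simp add: mult.assoc)
  qed
  show ?thesis
  proof (rule tendsto_unique[OF F])
    show "((\<lambda>i. \<phi> (a * b) (c * e i * d) - \<phi> a (b * (c * e i) * d)) \<longlongrightarrow>
        \<phi> (a * b) (c * d) - \<phi> a (b * c * d)) F"
      by (intro tendsto_diff tendsto tendsto_mult er tendsto_const)
    have "((\<lambda>i. \<phi> (d * a * b) (c * e i) - \<phi> (d * a) (b * (c * e i))) \<longlongrightarrow>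
        \<phi> (d * a * b) c - \<phi> (d * a) (b * c)) F"
      by (intro tendsto_diff tendsto tendsto_mult er tendsto_const)
    then show "((\<lambda>i. \<phi> (a * b) (c * e i * d) - \<phi> a (b * (c * e i) * d)) \<longlongrightarrow>
        \<phi> (d * a * b) c - \<phi> (d * a) (b * c)) F"
      using five[of c "e _" d] by (simp add: mult.assoc)
  qed
qed

section \<open>The cyclic sum\<close>

definition cyclic_sum :: "('a::times \<Rightarrow> 'a \<Rightarrow> complex) \<Rightarrow> 'a \<Rightarrow> 'a \<Rightarrow> 'a \<Rightarrow> complex"
  where "cyclic_sum \<phi> x y z = \<phi> x (y * z) + \<phi> y (z * x) + \<phi> z (x * y)"

lemma cyclic_sum_rotate: "cyclic_sum \<phi> x y z = cyclic_sum \<phi> y z x"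
  by (simp add: cyclic_sum_def)

lemma antisymmetric_if_zero_on_commuting:
  assumes "continuous_bilinear_functional \<phi>"
    and comm: "\<forall>a b. a * b = b * a \<longrightarrow> \<phi> a b = 0"
  shows "\<phi> b a = - \<phi> a b"
proof -
  interpret bounded_bilinear \<phi>
    using assms by (simp add: continuous_bilinear_functional_def)
  have diag: "\<phi> u u = 0" for u
    by (simp add: comm)
  have "\<phi> (a + b) (a + b) = \<phi> b a + \<phi> a b"
    by (simp only: add_left add_right diag[of a] diag[of b]) simp
  then have "\<phi> b a + \<phi> a b = 0"
    by (simp only: diag)
  then show ?thesis
    by (simp only: eq_neg_iff_add_eq_0)
qed

lemma cyclic_sum_shift:
  fixes \<phi> :: "'a::complex_banach_algebra \<Rightarrow> 'a \<Rightarrow> complex" and e :: "'i \<Rightarrow> 'a"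
  assumes B: "property_B TYPE('a)" and \<phi>: "continuous_bilinear_functional \<phi>"
    and comm: "\<forall>a b. a * b = b * a \<longrightarrow> \<phi> a b = 0"
    and e: "bounded_approximate_identity F e"
  shows "cyclic_sum \<phi> (a * b) c d = cyclic_sum \<phi> a (b * c) d"
proof -
  have "\<phi> (a * b) (c * d) - \<phi> a (b * c * d) = \<phi> (d * a * b) c - \<phi> (d * a) (b * c)"
    by (rule four_factor_identity[OF B \<phi> _ e]) (simp add: comm)
  moreover have "\<phi> c (d * a * b) = - \<phi> (d * a * b) c" "\<phi> (b * c) (d * a) = - \<phi> (d * a) (b * c)"
    by (rule antisymmetric_if_zero_on_commuting[OF \<phi> comm])+
  ultimately show ?thesis
    by (simp add: cyclic_sum_def mult.assoc algebra_simps)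
qed

text \<open>
  The two cyclic sums together contain \<open>\<phi>\<close> at all six orderings of \<open>x, y, z\<close>, which is the full
  polarisation of the cubic form \<open>\<phi>(x, x\<^sup>2)\<close>; this form is zero because \<open>x\<close> commutes with \<open>x\<^sup>2\<close>.
\<close>

lemma cyclic_sum_swap:
  assumes "continuous_bilinear_functional \<phi>"
    and comm: "\<forall>a b. a * b = b * a \<longrightarrow> \<phi> a b = 0"
  shows "cyclic_sum \<phi> x y z = - cyclic_sum \<phi> x z y"
proof -
  interpret bounded_bilinear \<phi>
    using assms by (simp add: continuous_bilinear_functional_def)
  have cube: "\<phi> u (u * u) = 0" for u
    by (rule comm[rule_format]) (simp add: mult.assoc)
  have mixed: "\<phi> u (u * v) + \<phi> u (v * u) + \<phi> v (u * u)
      + (\<phi> v (v * u) + \<phi> v (u * v) + \<phi> u (v * v)) = 0" for u v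
    using cube[of "u + v"] by (simp add: add_left add_right distrib_left distrib_right cube add_ac)
  (* The part of mixed that is quadratic in u and linear in v, polarised in u; the other part is
     linear in u and cancels. *)
  have "cyclic_sum \<phi> x y z + cyclic_sum \<phi> x z y = 0"
    using mixed[of "x + y" z] mixed[of x z] mixed[of y z]
    unfolding cyclic_sum_def add_left add_right distrib_left distrib_right by algebra
  then show ?thesis
    by (simp only: eq_neg_iff_add_eq_0)
qed

text \<open>
  Passing \<open>d\<close> to the left over \<open>b\<close> and \<open>c\<close> is an even number of exchanges if they are passed
  singly and an odd number if they are passed as the one argument \<open>b * c\<close>.
\<close>

lemma cyclic_sum_product_eq_0:
  fixes \<phi> :: "'a::complex_banach_algebra \<Rightarrow> 'a \<Rightarrow> complex" and e :: "'i \<Rightarrow> 'a"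
  assumes B: "property_B TYPE('a)" and \<phi>: "continuous_bilinear_functional \<phi>"
    and comm: "\<forall>a b. a * b = b * a \<longrightarrow> \<phi> a b = 0"
    and e: "bounded_approximate_identity F e"
  shows "cyclic_sum \<phi> (a * b) c d = 0"
proof -
  note shift = cyclic_sum_shift[OF B \<phi> comm e]
  note swap = cyclic_sum_swap[OF \<phi> comm]
  have "cyclic_sum \<phi> (a * b) c d = - cyclic_sum \<phi> (a * b) d c"
    by (rule swap)
  also have "cyclic_sum \<phi> (a * b) d c = cyclic_sum \<phi> (c * a) b d"
    by (simp only: shift[of c a b d] cyclic_sum_rotate[of \<phi> c "a * b" d])
  also have "- \<dots> = cyclic_sum \<phi> (c * a) d b"
    by (simp add: swap[of "c * a" b d])
  also have "\<dots> = cyclic_sum \<phi> a d (b * c)"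
    using shift[of b c a d] cyclic_sum_rotate[of \<phi> b "c * a" d] cyclic_sum_rotate[of \<phi> a d "b * c"]
      cyclic_sum_rotate[of \<phi> d "b * c" a] by argo
  also have "\<dots> = - cyclic_sum \<phi> a (b * c) d"
    by (rule swap)
  also have "\<dots> = - cyclic_sum \<phi> (a * b) c d"
    by (simp add: shift)
  finally show ?thesis
    by simp
qed

lemma cyclic_sum_eq_0:
  fixes \<phi> :: "'a::complex_banach_algebra \<Rightarrow> 'a \<Rightarrow> complex" and e :: "'i \<Rightarrow> 'a"
  assumes B: "property_B TYPE('a)" and \<phi>: "continuous_bilinear_functional \<phi>"
    and comm: "\<forall>a b. a * b = b * a \<longrightarrow> \<phi> a b = 0"
    and e: "bounded_approximate_identity F e"
  shows "cyclic_sum \<phi> x y z = 0"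
proof -
  have F: "F \<noteq> bot" and er: "((\<lambda>i. x * e i) \<longlongrightarrow> x) F"
    using e by (auto simp: bounded_approximate_identity_def)
  interpret bounded_bilinear \<phi>
    using \<phi> by (simp add: continuous_bilinear_functional_def)
  have "((\<lambda>i. cyclic_sum \<phi> (x * e i) y z) \<longlongrightarrow> cyclic_sum \<phi> x y z) F"
    unfolding cyclic_sum_def
    by (intro tendsto_add tendsto tendsto_mult er tendsto_const)
  then have "((\<lambda>i. 0) \<longlongrightarrow> cyclic_sum \<phi> x y z) F"
    by (simp add: cyclic_sum_product_eq_0[OF B \<phi> comm e])
  then show ?thesis
    using tendsto_unique[OF F _ tendsto_const] by blast
qed

section \<open>From derivations to commutators\<close>

lemma bounded_bilinear_curried:
  fixes \<phi> :: "'a::real_normed_vector \<Rightarrow> 'b::real_normed_vector \<Rightarrow> 'c::real_normed_vector"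
  assumes "bounded_bilinear \<phi>"
  obtains \<delta> :: "'a \<Rightarrow> ('b \<Rightarrow>\<^sub>L 'c)"
  where "bounded_linear \<delta>" and "\<And>a b. blinfun_apply (\<delta> a) b = \<phi> a b"
proof -
  interpret bounded_bilinear \<phi> by (rule assms)
  define \<delta> where "\<delta> a = Blinfun (\<phi> a)" for a
  have app: "blinfun_apply (\<delta> a) b = \<phi> a b" for a b
    by (simp add: \<delta>_def bounded_linear_Blinfun_apply bounded_linear_right)
  obtain K where "K \<ge> 0" and K: "norm (\<phi> a b) \<le> norm a * norm b * K" for a b
    using nonneg_bounded by blast
  have "bounded_linear \<delta>"
  proof (rule bounded_linear_intro[where K = K])
    show "norm (\<delta> a) \<le> norm a * K" for a
      using K[of a] \<open>K \<ge> 0\<close> by (intro norm_blinfun_bound) (simp_all add: app mult_ac)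
  qed (auto intro!: blinfun_eqI simp: app add_left scaleR_left blinfun.bilinear_simps)
  then show thesis
    using app that by blast
qed

theorem corollary2p8:
  fixes F :: "'i filter" and e :: "'i \<Rightarrow> 'a::complex_banach_algebra"
  assumes "weakly_amenable TYPE('a)"
    and "property_B TYPE('a)"
    and "bounded_approximate_identity F e"
  shows "zero_Lie_product_determined TYPE('a)"
  unfolding zero_Lie_product_determined_def
proof (intro allI impI, elim conjE)
  fix \<phi> :: "'a \<Rightarrow> 'a \<Rightarrow> complex"
  assume \<phi>: "continuous_bilinear_functional \<phi>" and comm: "\<forall>a b. a * b = b * a \<longrightarrow> \<phi> a b = 0"
  interpret bounded_bilinear \<phi>
    using \<phi> by (simp add: continuous_bilinear_functional_def)
  obtain \<delta> :: "'a \<Rightarrow> ('a \<Rightarrow>\<^sub>L complex)"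
    where "bounded_linear \<delta>" and app: "\<And>a b. blinfun_apply (\<delta> a) b = \<phi> a b"
    using bounded_bilinear_curried[OF bounded_bilinear_axioms] by blast
  have leibniz: "\<phi> (a * b) c = \<phi> a (b * c) + \<phi> b (c * a)" for a b c
    using cyclic_sum_eq_0[OF assms(2) \<phi> comm assms(3), of a b c]
      antisymmetric_if_zero_on_commuting[OF \<phi> comm, of "a * b" c]
    by (simp add: cyclic_sum_def add_eq_0_iff2)
  have "dual_derivation \<delta>"
    using \<phi>
    by (auto simp: dual_derivation_def dual_space_def continuous_bilinear_functional_def
        app dual_action_apply add_left leibniz blinfun.bilinear_simps intro!: blinfun_eqI)
  moreover have "continuous_on UNIV \<delta>"
    using \<open>bounded_linear \<delta>\<close> by (rule linear_continuous_on)
  ultimately obtain \<omega> where \<omega>: "\<omega> \<in> dual_space" and inner: "\<And>a. \<delta> a = dual_lact a \<omega> - dual_ract \<omega> a"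
    using assms(1) unfolding weakly_amenable_def inner_derivation_def by blast
  (* The inner derivation of \<omega> takes a to the functional \<omega>(ba - ab) of b, whence the sign. *)
  show "\<exists>\<omega>\<in>dual_space. \<forall>a b. \<phi> a b = blinfun_apply \<omega> (a * b - b * a)"
  proof (intro bexI allI)
    show "- \<omega> \<in> dual_space"
      using \<omega> by (simp add: dual_space_def blinfun.bilinear_simps)
    show "\<phi> a b = blinfun_apply (- \<omega>) (a * b - b * a)" for a b
      unfolding app[symmetric] inner
      by (simp add: dual_action_apply blinfun.bilinear_simps)
  qed
qed

end
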